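(* Let $S_{n,k}$ be as defined (weights $a_j=1$), and let $n,k$ tend to infinity along sequences as indicated; convergence is in distribution. (1) If $n\to\infty$ and $k/\sqrt n\to0$, then $S_{n,k}\to0$. If $k\to\infty$ and $n/\sqrt k\to0$ (with $n\ge1$), then $S_{n,k}-k+n\to0$. (2) If $n,k\to\infty$ with $k/\sqrt n\to c>0$, then $S_{n,k}\to\mathrm{Po}(c^2)$. If $n,k\to\infty$ with $n/\sqrt k\to c>0$, then $S_{n,k}-k+n\to\mathrm{Po}(c^2)$. (3) If $n,k\to\infty$ with $k/\sqrt n\to\infty$ and $k/n^2\to0$, then $\frac{S_{n,k}-\mathbb E(S_{n,k})}{\sqrt{\mathbb V(S_{n,k})}}\to\mathcal N(0,1)$.
   Context: For $\vec\ell=(\ell_1,\dots,\ell_k)$ with $n\ge\ell_1\ge\cdots\ge\ell_k\ge1$ let $\sigma(\vec\ell)=|\{1\le j\le k-1:\ell_j=\ell_{j+1}\}|$. $S_{n,k}$ denotes the value of $\sigma$ on a uniformly random element of this set (uniform random $k$-multiset of $\{1,\dots,n\}$); equivalently $\mathbb P\{S_{n,k}=j\}=\binom{n}{k-j}\binom{k-1}{j}/\binom{n+k-1}{k}$. $\mathrm{Po}(\lambda)$ is the Poisson law with mean $\lambda$ and $\mathcal N(0,1)$ the standard normal law. *)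

theory Defs
  imports "HOL-Probability.Probability"
begin

definition mseq_set :: "nat \<Rightarrow> nat \<Rightarrow> nat list set" where
  "mseq_set n k = {l. length l = k \<and> sorted_wrt (\<ge>) l \<and> set l \<subseteq> {1..n}}"

definition sigma :: "nat list \<Rightarrow> nat" where
  "sigma l = card {j. Suc j < length l \<and> l ! j = l ! Suc j}"

definition S_dist :: "nat \<Rightarrow> nat \<Rightarrow> nat pmf" where
  "S_dist n k = map_pmf sigma (pmf_of_set (mseq_set n k))"

definition S_shift_law :: "nat \<Rightarrow> nat \<Rightarrow> real measure" where
  "S_shift_law n k = measure_pmf (map_pmf (\<lambda>s. real s - real k + real n) (S_dist n k))"

definition S_law :: "nat \<Rightarrow> nat \<Rightarrow> real measure" where
  "S_law n k = measure_pmf (map_pmf real (S_dist n k))"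

definition S_mean :: "nat \<Rightarrow> nat \<Rightarrow> real" where
  "S_mean n k = measure_pmf.expectation (S_dist n k) real"

definition S_var :: "nat \<Rightarrow> nat \<Rightarrow> real" where
  "S_var n k = measure_pmf.variance (S_dist n k) real"

definition S_std_law :: "nat \<Rightarrow> nat \<Rightarrow> real measure" where
  "S_std_law n k = measure_pmf (map_pmf (\<lambda>s. (real s - S_mean n k) / sqrt (S_var n k)) (S_dist n k))"

definition Po_law :: "real \<Rightarrow> real measure" where
  "Po_law r = measure_pmf (map_pmf real (poisson_pmf r))"

definition dirac0 :: "real measure" where
  "dirac0 = measure_pmf (return_pmf 0)"

end

theory Submission
  imports Defs "HOL-Computational_Algebra.Fundamental_Theorem_Algebra"
begin

text \<open>
  \<open>S\<^sub>n\<^sub>,\<^sub>k\<close> is hypergeometric, and its generating polynomial has only real roots: by a Rodrigues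
  formula it is, up to a Moebius substitution, the \<open>k\<close>-th derivative of \<open>y\<^sup>n (y - 1)\<^sup>k\<^sup>-\<^sup>1\<close>.
  Hence \<open>S\<^sub>n\<^sub>,\<^sub>k\<close> is distributed as a sum of independent Bernoulli variables with parameters \<open>p\<^sub>i\<close>, and
  factorwise comparison of characteristic functions shows that the law is close to a Poisson law
  when \<open>\<Sum> p\<^sub>i\<^sup>2 = E - V\<close> is small, and after standardisation close to the normal law when \<open>V\<close> is
  large. The statements on \<open>S\<^sub>n\<^sub>,\<^sub>k - k + n\<close> follow because this variable has the law of \<open>S\<^sub>k\<^sub>,\<^sub>n\<close>.
\<close>

section \<open>Real-rootedness of hypergeometric polynomials\<close>

text \<open>The ties are dependent, and the parameters p_i, which come from the roots, are not
  explicit. This does no harm: the error bounds see them only through the sums of p_i and of p_i (1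
  - p_i), that is, through E and V, which are explicit rational functions of n and k. If k / sqrt n
  tends to c, then E tends to c^2 and E - V to 0; the case c = 0 is the degenerate limit. For the
  normal limit, 1 / V <= 16 (n / k^2 + k / n^2), and the two hypotheses on the growth of k say that
  both summands vanish. Convergence in distribution is obtained from characteristic functions by
  Levy's continuity theorem.\<close>

lemma pderiv_linear_factors:
  fixes r :: "nat \<Rightarrow> 'a::field_char_0"
  assumes "\<And>i. i < d \<Longrightarrow> z \<noteq> r i"
  shows "poly (pderiv (\<Prod>i<d. [:- r i, 1:])) z = (\<Prod>i<d. z - r i) * (\<Sum>i<d. 1 / (z - r i))"
  using assms
proof (induction d)
  case (Suc d)
  have "poly (pderiv (\<Prod>i<Suc d. [:- r i, 1:])) z =
      (\<Prod>i<d. z - r i) + (z - r d) * poly (pderiv (\<Prod>i<d. [:- r i, 1:])) z"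
    by (simp add: pderiv_mult pderiv_pCons poly_prod del: mult_pCons_left mult_pCons_right)
  also have "\<dots> = (\<Prod>i<Suc d. z - r i) * (\<Sum>i<Suc d. 1 / (z - r i))"
    using Suc by (simp add: field_simps)
  finally show ?case .
qed simp

text \<open>For nonreal \<open>z\<close> the imaginary parts of all terms \<open>1 / (z - r)\<close> of the
  logarithmic derivative have the same strict sign.\<close>

lemma real_rooted_pderiv:
  fixes p :: "complex poly"
  assumes real: "\<And>z. poly p z = 0 \<Longrightarrow> z \<in> \<real>" and deg: "degree p > 0"
    and root: "poly (pderiv p) z = 0"
  shows "z \<in> \<real>"
proof (rule ccontr)
  assume nr: "z \<notin> \<real>"
  obtain r where r: "smult (lead_coeff p) (\<Prod>i<degree p. [:- r i, 1:]) = p"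
    using complex_poly_decompose' by blast
  let ?d = "degree p" and ?q = "\<Prod>i<degree p. [:- r i, 1:]"
  have lc: "lead_coeff p \<noteq> 0"
    using deg by auto
  have "poly p (r i) = 0" if "i < ?d" for i
    using that by (subst r [symmetric]) (auto simp: poly_prod)
  with real have rr: "r i \<in> \<real>" if "i < ?d" for i
    using that by blast
  then have ne: "z \<noteq> r i" if "i < ?d" for i
    using nr that by blast
  have "poly (pderiv (smult (lead_coeff p) ?q)) z = 0"
    using root r by simp
  then have "poly (pderiv ?q) z = 0"
    using lc by (simp add: pderiv_smult)
  then have "(\<Prod>i<?d. z - r i) * (\<Sum>i<?d. 1 / (z - r i)) = 0"
    using pderiv_linear_factors [of ?d z r] ne by simp
  moreover have "(\<Prod>i<?d. z - r i) \<noteq> 0"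
    using ne by simp
  ultimately have "Im (\<Sum>i<?d. 1 / (z - r i)) = 0"
    by simp
  then have "(\<Sum>i<?d. Im (1 / (z - r i))) = 0"
    by simp
  also have "(\<Sum>i<?d. Im (1 / (z - r i))) = (\<Sum>i<?d. - Im z / (cmod (z - r i))\<^sup>2)"
    by (intro sum.cong) (auto simp: Im_divide cmod_power2 complex_is_Real_iff dest: rr)
  also have "\<dots> = - Im z * (\<Sum>i<?d. 1 / (cmod (z - r i))\<^sup>2)"
    by (simp add: sum_distrib_left)
  finally have "Im z = 0 \<or> (\<Sum>i<?d. 1 / (cmod (z - r i))\<^sup>2) = 0"
    by simp
  moreover have "(\<Sum>i<?d. 1 / (cmod (z - r i))\<^sup>2) > 0"
    using deg ne by (intro sum_pos) auto
  ultimately show False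
    using nr by (auto simp: complex_is_Real_iff)
qed

text \<open>The bound \<open>c \<le> degree p\<close> ensures that each polynomial being
  differentiated is nonconstant; beyond the degree the derivative is 0 and every \<open>z\<close> is
  a root.\<close>

lemma real_rooted_higher_pderiv:
  fixes p :: "complex poly"
  assumes "\<And>z. poly p z = 0 \<Longrightarrow> z \<in> \<real>" and "c \<le> degree p" and "p \<noteq> 0"
    and "poly ((pderiv ^^ c) p) z = 0"
  shows "z \<in> \<real>"
  using assms(2,4)
proof (induction c arbitrary: z)
  case 0
  then show ?case using assms(1) by simp
next
  case (Suc c)
  then show ?case
    using real_rooted_pderiv [of "(pderiv ^^ c) p" z] by (simp add: degree_higher_pderiv)
qed

lemma higher_pderiv_mult:
  fixes p q :: "'a::{comm_semiring_1,semiring_no_zero_divisors} poly"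
  shows "(pderiv ^^ c) (p * q) =
    (\<Sum>j\<le>c. of_nat (c choose j) * ((pderiv ^^ (c - j)) p * (pderiv ^^ j) q))"
proof (induction c)
  case 0
  then show ?case by simp
next
  case (Suc c)
  let ?t = "\<lambda>c j. of_nat (c choose j) * ((pderiv ^^ (Suc c - j)) p * (pderiv ^^ j) q)"
  let ?f = "\<lambda>j. (pderiv ^^ (Suc c - j)) p * (pderiv ^^ j) q"
  have D: "pderiv (of_nat m * r) = of_nat m * pderiv r" for m and r :: "'a poly"
    by (induction m) (simp_all add: pderiv_add algebra_simps)
  have S: "pderiv (sum f A) = (\<Sum>x\<in>A. pderiv (f x))" for f :: "nat \<Rightarrow> 'a poly" and A
    using higher_pderiv_sum [of 1 f A] by simp
  have "(pderiv ^^ Suc c) (p * q) =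
      (\<Sum>j\<le>c. of_nat (c choose j) * (?f j + ?f (Suc j)))"
    unfolding funpow.simps comp_def Suc.IH S D
    by (intro sum.cong refl) (simp add: pderiv_mult Suc_diff_le algebra_simps)
  also have "\<dots> = (\<Sum>j\<le>c. of_nat (c choose j) * ?f j) + (\<Sum>j\<le>c. of_nat (c choose j) * ?f (Suc j))"
    by (simp add: algebra_simps sum.distrib)
  \<comment> \<open>The added term has coefficient \<open>c choose Suc c = 0\<close>. Splitting off
    \<open>j = 0\<close> then aligns both sums for Pascal's rule.\<close>
  also have "(\<Sum>j\<le>c. of_nat (c choose j) * ?f j) = (\<Sum>j\<le>Suc c. of_nat (c choose j) * ?f j)"
    by (simp add: binomial_eq_0)
  also have "\<dots> = ?f 0 + (\<Sum>j\<le>c. of_nat (c choose Suc j) * ?f (Suc j))"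
    by (subst sum.atMost_Suc_shift) simp
  finally have "(pderiv ^^ Suc c) (p * q) =
     ?f 0 + (\<Sum>j\<le>c. of_nat (Suc c choose Suc j) * ?f (Suc j))"
    by (simp add: algebra_simps sum.distrib)
  also have "\<dots> = (\<Sum>j\<le>Suc c. of_nat (Suc c choose j) * ?f j)"
    by (subst sum.atMost_Suc_shift) simp
  finally show ?case .
qed

lemma higher_pderiv_linear_power:
  fixes r :: "'a::field_char_0"
  assumes "m \<le> a"
  shows "(pderiv ^^ m) ([:- r, 1:] ^ a) =
    smult (fact m * of_nat (a choose m)) ([:- r, 1:] ^ (a - m))"
  using assms
proof (induction m)
  case 0
  then show ?case by simp
next
  case (Suc m)
  then obtain e where e: "a - m = Suc e" "a - Suc m = e"
    by (metis Suc_diff_Suc Suc_le_lessD)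
  have *: "of_nat (a choose m) * of_nat (Suc e) = of_nat (Suc m) * (of_nat (a choose Suc m) :: 'a)"
  proof -
    have "(a choose m) * (a - m) = Suc m * (a choose Suc m)"
      using binomial_absorb_comp [of a m] binomial_absorption [of m a]
      by (simp only: mult.commute)
    then show ?thesis
      unfolding e by (simp only: flip: of_nat_mult)
  qed
  have "(pderiv ^^ Suc m) ([:- r, 1:] ^ a) =
      smult (fact m * of_nat (a choose m)) (pderiv ([:- r, 1:] ^ Suc e))"
    using Suc e by (simp add: pderiv_smult)
  also have "\<dots> = smult (fact m * (of_nat (a choose m) * of_nat (Suc e))) ([:- r, 1:] ^ e)"
    by (simp add: pderiv_power_Suc pderiv_pCons mult.assoc del: of_nat_Suc power_Suc)
  also have "\<dots> = smult (fact (Suc m) * of_nat (a choose Suc m)) ([:- r, 1:] ^ e)"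
    unfolding * by (simp add: algebra_simps)
  finally show ?case using e by simp
qed

lemma higher_pderiv_linear_power_eq_0:
  fixes r :: "'a::field_char_0"
  assumes "a < m"
  shows "(pderiv ^^ m) ([:- r, 1:] ^ a) = 0"
proof -
  obtain e where "m = e + Suc 0 + a"
    using assms less_iff_Suc_add [of a m] by auto
  then have "(pderiv ^^ m) ([:- r, 1:] ^ a) = (pderiv ^^ e) (pderiv ((pderiv ^^ a) ([:- r, 1:] ^ a)))"
    by (simp add: funpow_add funpow_swap1)
  then show ?thesis by (simp add: higher_pderiv_linear_power pderiv_smult)
qed

text \<open>Multiplying by \<open>(y - r) ^ m\<close> avoids the exponent \<open>a - m\<close>, so
  one formula covers \<open>m > a\<close> as well, where both sides vanish.\<close>

lemma poly_higher_pderiv_linear_power: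
  fixes r :: "'a::field_char_0"
  shows "poly ((pderiv ^^ m) ([:- r, 1:] ^ a)) y * (y - r) ^ m =
    fact m * of_nat (a choose m) * (y - r) ^ a"
proof (cases "m \<le> a")
  case True
  then show ?thesis
    by (simp add: higher_pderiv_linear_power poly_power mult.assoc flip: power_add)
next
  case False
  then show ?thesis
    by (simp add: higher_pderiv_linear_power_eq_0)
qed

text \<open>In Leibniz's rule the factorials of the two derivatives combine with
  \<open>c choose j\<close> to \<open>fact c\<close>. What remains is the hypergeometric sum in the
  variable \<open>y / (y - 1)\<close>.\<close>

lemma rodrigues_hypergeometric:
  fixes y :: "'a::field_char_0"
  assumes "y \<noteq> 1"
  shows "poly ((pderiv ^^ c) ([:0, 1:] ^ a * [:- 1, 1:] ^ b)) y * y ^ c =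
    fact c * y ^ a * (y - 1) ^ b *
      (\<Sum>j\<le>c. of_nat (a choose (c - j)) * of_nat (b choose j) * (y / (y - 1)) ^ j)"
proof -
  let ?A = "\<lambda>m. poly ((pderiv ^^ m) ([:- 0, 1:] ^ a)) y"
  let ?B = "\<lambda>m. poly ((pderiv ^^ m) ([:- 1, 1:] ^ b)) y"
  have "poly ((pderiv ^^ c) ([:0, 1:] ^ a * [:- 1, 1:] ^ b)) y * y ^ c =
    (\<Sum>j\<le>c. of_nat (c choose j) * (?A (c - j) * ?B j) * y ^ c)"
    by (simp add: higher_pderiv_mult poly_sum sum_distrib_right)
  also have "\<dots> = (\<Sum>j\<le>c. fact c * y ^ a * (y - 1) ^ b *
      (of_nat (a choose (c - j)) * of_nat (b choose j) * (y / (y - 1)) ^ j))"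
  proof (intro sum.cong refl)
    fix j assume "j \<in> {..c}"
    then have j: "j \<le> c" by simp
    have y: "y ^ c = y ^ (c - j) * y ^ j"
      using j by (simp flip: power_add)
    have B: "?B j = fact j * of_nat (b choose j) * (y - 1) ^ b / (y - 1) ^ j"
      using poly_higher_pderiv_linear_power [of j 1 b y] assms by (simp add: field_simps)
    have f: "of_nat (c choose j) * fact j * fact (c - j) = (fact c :: 'a)"
      using arg_cong [OF binomial_fact_lemma [OF j], of "of_nat :: nat \<Rightarrow> 'a"]
      by (simp only: of_nat_mult of_nat_fact mult_ac)
    have "of_nat (c choose j) * (?A (c - j) * ?B j) * y ^ c =
        of_nat (c choose j) * (?A (c - j) * (y - 0) ^ (c - j)) * ?B j * y ^ j"
      using y by (simp add: algebra_simps)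
    also have "\<dots> = of_nat (c choose j) * (fact (c - j) * of_nat (a choose (c - j)) * y ^ a)
        * (fact j * of_nat (b choose j) * (y - 1) ^ b / (y - 1) ^ j) * y ^ j"
      unfolding poly_higher_pderiv_linear_power B by simp
    also have "\<dots> = (of_nat (c choose j) * fact j * fact (c - j)) * y ^ a * (y - 1) ^ b *
      (of_nat (a choose (c - j)) * of_nat (b choose j) * (y / (y - 1)) ^ j)"
      by (simp add: power_divide)
    finally show "of_nat (c choose j) * (?A (c - j) * ?B j) * y ^ c = fact c * y ^ a * (y - 1) ^ b *
      (of_nat (a choose (c - j)) * of_nat (b choose j) * (y / (y - 1)) ^ j)"
      unfolding f .
  qed
  finally show ?thesis
    by (simp add: sum_distrib_left)
qed

text \<open>The map sending \<open>x\<close> to \<open>x / (x - 1)\<close> is an involution with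
  real coefficients, so a nonreal root \<open>x\<close> gives a nonreal root \<open>y\<close> of a
  derivative of a polynomial of degree \<open>a + b\<close> whose roots lie in {0, 1}.\<close>

lemma hypergeometric_real_rooted:
  fixes x :: complex
  assumes "c \<le> a + b"
    and zero: "(\<Sum>j\<le>c. of_nat (a choose (c - j)) * of_nat (b choose j) * x ^ j) = 0"
  shows "x \<in> \<real>"
proof (rule ccontr)
  assume nr: "x \<notin> \<real>"
  define y where "y = x / (x - 1)"
  let ?p = "[:0, 1:] ^ a * [:- 1, 1:] ^ b :: complex poly"
  have x1: "x \<noteq> 1" "x \<noteq> 0"
    using nr by auto
  then have y: "y \<noteq> 1" "y \<noteq> 0" and xy: "y / (y - 1) = x"
    by (auto simp: y_def field_simps)
  have ynr: "y \<notin> \<real>"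
    using nr by (metis Reals_1 Reals_diff Reals_divide xy)
  have "poly ((pderiv ^^ c) ?p) y * y ^ c = 0"
    using rodrigues_hypergeometric [of y c a b] y zero unfolding xy by simp
  then have "poly ((pderiv ^^ c) ?p) y = 0"
    using y by simp
  moreover have "z \<in> \<real>" if "poly ?p z = 0" for z
    using that by (auto simp: poly_power)
  moreover have "?p \<noteq> 0"
    by simp
  moreover have "degree ?p = a + b"
    by (subst degree_mult_eq) (auto simp: degree_power_eq)
  ultimately show False
    using real_rooted_higher_pderiv [of ?p c y] assms(1) ynr by simp
qed

section \<open>The distribution of the number of ties\<close>

lemma finite_mseq_set: "finite (mseq_set n k)"
  by (rule finite_subset [OF _ finite_lists_length_eq [of "{1..n}" k]]) (auto simp: mseq_set_def)

lemma mseq_set_0_right: "mseq_set n 0 = {[]}"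
  by (auto simp: mseq_set_def)

lemma mseq_set_0_left: "k > 0 \<Longrightarrow> mseq_set 0 k = {}"
  by (auto simp: mseq_set_def)

lemma sigma_Cons_Cons: "sigma (a # b # l) = (if a = b then 1 else 0) + sigma (b # l)"
proof -
  let ?T = "\<lambda>l. {j. Suc j < length l \<and> l ! j = l ! Suc j}"
  have fin: "finite (?T l)" for l :: "nat list"
    by (rule finite_subset [of _ "{..<length l}"]) auto
  have "?T (a # b # l) = (if a = b then {0} else {}) \<union> Suc ` ?T (b # l)"
  proof (intro set_eqI)
    fix j
    show "j \<in> ?T (a # b # l) \<longleftrightarrow> j \<in> (if a = b then {0} else {}) \<union> Suc ` ?T (b # l)"
      by (cases j) (auto simp: image_iff)
  qed
  moreover have "card ((if a = b then {0} else {}) \<union> Suc ` ?T (b # l)) =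
      card (if a = b then {0::nat} else {}) + card (Suc ` ?T (b # l))"
    using fin [of "b # l"] by (intro card_Un_disjoint) auto
  ultimately show ?thesis
    by (simp add: sigma_def card_image)
qed

lemma sigma_Nil: "sigma [] = 0" and sigma_single: "sigma [a] = 0"
  by (simp_all add: sigma_def)

definition mseq_sigma :: "nat \<Rightarrow> nat \<Rightarrow> nat \<Rightarrow> nat list set" where
  "mseq_sigma n k j = {l \<in> mseq_set n k. sigma l = j}"

text \<open>Whether a new first entry creates a tie depends on the entry after it. A recursion for
  the tie count therefore needs this second family, in which the head is fixed to the largest
  value.\<close>

definition mseq_sigma_top :: "nat \<Rightarrow> nat \<Rightarrow> nat \<Rightarrow> nat list set" where
  "mseq_sigma_top n k j = {l. Suc n # l \<in> mseq_sigma (Suc n) (Suc k) j}"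

lemma finite_mseq_sigma: "finite (mseq_sigma n k j)"
  by (simp add: mseq_sigma_def finite_mseq_set)

lemma finite_mseq_sigma_top: "finite (mseq_sigma_top n k j)"
proof -
  have "finite ((\<lambda>l. Suc n # l) ` mseq_sigma_top n k j)"
    by (rule finite_subset [OF _ finite_mseq_sigma [of "Suc n" "Suc k" j]])
      (auto simp: mseq_sigma_top_def)
  then show ?thesis
    by (rule finite_imageD) (auto simp: inj_on_def)
qed

lemma Cons_mseq_set: "a # l \<in> mseq_set n (Suc k) \<longleftrightarrow> a \<in> {1..n} \<and> l \<in> mseq_set a k"
  by (fastforce simp: mseq_set_def)

lemma card_mseq_sigma_Suc:
  "card (mseq_sigma (Suc n) (Suc k) j) = card (mseq_sigma n (Suc k) j) + card (mseq_sigma_top n k j)"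
proof -
  have "mseq_sigma (Suc n) (Suc k) j =
      mseq_sigma n (Suc k) j \<union> (\<lambda>l. Suc n # l) ` mseq_sigma_top n k j" (is "_ = ?A \<union> ?B")
  proof (intro set_eqI)
    fix l :: "nat list"
    show "l \<in> mseq_sigma (Suc n) (Suc k) j \<longleftrightarrow> l \<in> ?A \<union> ?B"
    proof (cases l)
      case Nil
      then show ?thesis by (auto simp: mseq_sigma_def mseq_set_def)
    next
      case (Cons a l')
      then show ?thesis
        by (auto simp: mseq_sigma_def mseq_sigma_top_def Cons_mseq_set le_Suc_eq)
    qed
  qed
  moreover have "?A \<inter> ?B = {}"
    by (auto simp: mseq_sigma_def Cons_mseq_set)
  ultimately show ?thesis
    using finite_mseq_sigma [of n "Suc k" j] finite_mseq_sigma_top [of n k j]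
    by (simp add: card_Un_disjoint card_image inj_on_def)
qed

lemma card_mseq_sigma_top_0: "card (mseq_sigma_top n 0 j) = (if j = 0 then 1 else 0)"
proof -
  have "mseq_sigma_top n 0 j = (if j = 0 then {[]} else {})"
    by (auto simp: mseq_sigma_top_def mseq_sigma_def Cons_mseq_set mseq_set_0_right sigma_single)
  then show ?thesis by simp
qed

text \<open>After the head \<open>Suc n\<close> comes either another \<open>Suc n\<close>, which
  costs one tie and is impossible for \<open>j = 0\<close>, or a smaller value, which costs
  none.\<close>

lemma card_mseq_sigma_top_Suc:
  "card (mseq_sigma_top n (Suc k) j) =
    (if j = 0 then 0 else card (mseq_sigma_top n k (j - 1))) + card (mseq_sigma n (Suc k) j)"
proof -
  have "mseq_sigma_top n (Suc k) j =
      (if j = 0 then {} else (\<lambda>l. Suc n # l) ` mseq_sigma_top n k (j - 1)) \<union>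
        mseq_sigma n (Suc k) j" (is "_ = ?A \<union> ?B")
  proof (intro set_eqI)
    fix l :: "nat list"
    show "l \<in> mseq_sigma_top n (Suc k) j \<longleftrightarrow> l \<in> ?A \<union> ?B"
    proof (cases l)
      case Nil
      then show ?thesis
        by (auto simp: mseq_sigma_def mseq_sigma_top_def Cons_mseq_set mseq_set_def)
    next
      case (Cons a l')
      then show ?thesis
        by (auto simp: mseq_sigma_def mseq_sigma_top_def Cons_mseq_set sigma_Cons_Cons le_Suc_eq)
    qed
  qed
  moreover have "?A \<inter> ?B = {}"
    by (auto simp: mseq_sigma_def Cons_mseq_set)
  ultimately show ?thesis
    using finite_mseq_sigma [of n "Suc k" j] finite_mseq_sigma_top [of n k "j - 1"]
    by (simp add: card_Un_disjoint card_image inj_on_def)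
qed

text \<open>The guard \<open>j \<le> k\<close> excludes the junk value \<open>n choose 0\<close> of the truncated difference.\<close>

lemma card_mseq_sigma_aux:
  "card (mseq_sigma n (Suc k) j) = (if j \<le> k then (n choose (Suc k - j)) * (k choose j) else 0) \<and>
   card (mseq_sigma_top n k j) = (if j \<le> k then (n choose (k - j)) * (k choose j) else 0)"
proof (induction n arbitrary: k j)
  case 0
  have A: "mseq_sigma 0 (Suc k) j = {}" for k j
    by (simp add: mseq_sigma_def mseq_set_0_left)
  have "card (mseq_sigma_top 0 k j) = (if j \<le> k then (0 choose (k - j)) * (k choose j) else 0)"
    by (induction k arbitrary: j) (auto simp: card_mseq_sigma_top_0 card_mseq_sigma_top_Suc A binomial_eq_0_iff)
  then show ?case
    by (simp add: A Suc_diff_le)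
next
  case (Suc n)
  \<comment> \<open>\<open>F\<close> is Pascal's rule in \<open>n\<close>. It is proved first and
    for all \<open>k\<close>, because the recursion for the second claim refers to the first at the
    same \<open>Suc n\<close>; that claim is then Pascal's rule in \<open>k\<close>.\<close>
  have F: "card (mseq_sigma (Suc n) (Suc k) j) =
      (if j \<le> k then (Suc n choose (Suc k - j)) * (k choose j) else 0)" for k j
    by (auto simp: card_mseq_sigma_Suc Suc.IH Suc_diff_le algebra_simps)
  have "card (mseq_sigma_top (Suc n) k j) =
      (if j \<le> k then (Suc n choose (k - j)) * (k choose j) else 0)"
  proof (induction k arbitrary: j)
    case 0
    then show ?case by (simp add: card_mseq_sigma_top_0)
  next
    case (Suc k)
    show ?case
    proof (cases j)
      case 0
      then show ?thesis by (simp add: card_mseq_sigma_top_Suc F)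
    next
      case (Suc i)
      then show ?thesis
        using Suc.IH [of i]
        by (auto simp: card_mseq_sigma_top_Suc F algebra_simps binomial_eq_0 not_le Suc_diff_le)
    qed
  qed
  with F show ?case by blast
qed

text \<open>For \<open>k > 0\<close> the factor \<open>(k - 1) choose j\<close> is 0 once
  \<open>j \<ge> k\<close> and so takes over the guard. At \<open>k = 0\<close> the truncated
  \<open>k - 1 = 0\<close> leaves exactly the empty sequence.\<close>

lemma card_mseq_sigma:
  "card (mseq_sigma n k j) = (n choose (k - j)) * ((k - 1) choose j)"
proof (cases k)
  case 0
  have "mseq_sigma n 0 j = (if j = 0 then {[]} else {})"
    by (auto simp: mseq_sigma_def mseq_set_0_right sigma_Nil)
  then show ?thesis using 0 by (auto simp: binomial_eq_0)
next
  case (Suc k')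
  then show ?thesis
    using card_mseq_sigma_aux [of n k' j] by (auto simp: binomial_eq_0)
qed

lemma card_mseq_set:
  assumes "n > 0 \<or> k > 0"
  shows "card (mseq_set n k) = (n + k - 1) choose k"
proof -
  have "mseq_set n k = (\<Union>j\<in>{..k}. mseq_sigma n k j)"
  proof (intro equalityI subsetI)
    fix l assume l: "l \<in> mseq_set n k"
    have "sigma l \<le> card {..<length l}"
      unfolding sigma_def by (intro card_mono) auto
    with l show "l \<in> (\<Union>j\<in>{..k}. mseq_sigma n k j)"
      by (simp add: mseq_set_def mseq_sigma_def)
  qed (auto simp: mseq_sigma_def)
  then have "card (mseq_set n k) = card (\<Union>j\<in>{..k}. mseq_sigma n k j)"
    by simp
  also have "\<dots> = (\<Sum>j\<le>k. card (mseq_sigma n k j))"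
    by (intro card_UN_disjoint) (auto simp: finite_mseq_sigma, auto simp: mseq_sigma_def)
  also have "\<dots> = (\<Sum>j\<le>k. ((k - 1) choose j) * (n choose (k - j)))"
    by (simp add: card_mseq_sigma mult.commute)
  also have "\<dots> = (k - 1 + n) choose k"
    by (rule vandermonde)
  \<comment> \<open>At \<open>k = 0\<close> the truncated differences may disagree, but both
    binomials are then of the form \<open>_ choose 0\<close>.\<close>
  also have "k - 1 + n = n + k - 1 \<or> k = 0"
    by auto
  then have "(k - 1 + n) choose k = (n + k - 1) choose k"
    by auto
  finally show ?thesis .
qed

lemma pmf_S_dist:
  assumes "n > 0"
  shows "pmf (S_dist n k) j =
    real (n choose (k - j)) * real ((k - 1) choose j) / real ((n + k - 1) choose k)"
proof -
  have c: "card (mseq_set n k) = (n + k - 1) choose k"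
    using assms by (simp add: card_mseq_set)
  \<comment> \<open>\<open>n > 0\<close> gives \<open>k \<le> n + k - 1\<close>. Nonemptiness
    matters because \<open>pmf_of_set\<close> is only meaningful on nonempty finite sets.\<close>
  then have "card (mseq_set n k) > 0"
    using assms by simp
  then have ne: "mseq_set n k \<noteq> {}"
    by auto
  have "pmf (S_dist n k) j = measure (measure_pmf (pmf_of_set (mseq_set n k))) (sigma -` {j})"
    by (simp add: S_dist_def pmf_map)
  also have "\<dots> = real (card (mseq_set n k \<inter> sigma -` {j})) / real (card (mseq_set n k))"
    using ne finite_mseq_set by (simp add: measure_pmf_of_set)
  also have "mseq_set n k \<inter> sigma -` {j} = mseq_sigma n k j"
    by (auto simp: mseq_sigma_def)
  finally show ?thesis
    by (simp add: c card_mseq_sigma)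
qed

lemma set_pmf_S_dist:
  assumes "n > 0"
  shows "set_pmf (S_dist n k) = {j. k \<le> n + j \<and> j \<le> k - 1}"
  using assms by (auto simp: set_pmf_eq pmf_S_dist)

text \<open>A sequence with s ties has D = k - s distinct values, and the law of D is symmetric in n
  and k: exchanging them multiplies both C(n,D) C(k-1,D-1) and C(n+k-1,k) by k / n. On the support
  \<open>k \<le> n + s\<close>, so the subtraction is exact.\<close>

lemma S_dist_swap:
  assumes "n > 0" "k > 0"
  shows "map_pmf (\<lambda>s. s + n - k) (S_dist n k) = S_dist k n"
proof (rule pmf_eqI)
  fix i
  let ?f = "\<lambda>s. s + n - k"
  have inj: "inj_on ?f (set_pmf (S_dist n k))"
    using assms by (auto simp: inj_on_def set_pmf_S_dist)
  show "pmf (map_pmf ?f (S_dist n k)) i = pmf (S_dist k n) i"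
  \<comment> \<open>The condition says that \<open>i + k - n\<close> is an exact difference and lies
    in the support of \<open>S_dist n k\<close>.\<close>
  proof (cases "k \<le> i + k - n + n \<and> i + k - n \<le> k - 1 \<and> n \<le> i + k")
    case True
    define s where "s = i + k - n"
    have s: "s \<in> set_pmf (S_dist n k)" and i: "i = s + n - k"
      using True assms by (auto simp: set_pmf_S_dist s_def)
    have "pmf (map_pmf ?f (S_dist n k)) i = pmf (S_dist n k) s"
      unfolding i using pmf_map_inj [OF inj s] .
    also have "\<dots> = real (n choose (k - s)) * real ((k - 1) choose s) / real ((n + k - 1) choose k)"
      by (rule pmf_S_dist [OF assms(1)])
    also have "\<dots> = real (k choose (n - i)) * real ((n - 1) choose i) / real ((k + n - 1) choose n)"
    proof -
      \<comment> \<open>\<open>Suc e = n - i = k - s\<close> is the common number of distinct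
        values; expressing \<open>n\<close> and \<open>k\<close> through it removes all truncated
        differences.\<close>
      define e where "e = n - i - 1"
      have eq: "n = Suc (i + e)" "k = Suc (s + e)"
        using True assms by (auto simp: s_def e_def)
      have "real (n choose Suc e) = fact n / (fact (Suc e) * fact i)"
        "real ((k - 1) choose s) = fact (k - 1) / (fact s * fact e)"
        "real (k choose Suc e) = fact k / (fact (Suc e) * fact s)"
        "real ((n - 1) choose i) = fact (n - 1) / (fact i * fact e)"
        "real ((n + k - 1) choose k) = fact (n + k - 1) / (fact k * fact (n - 1))"
        "real ((k + n - 1) choose n) = fact (n + k - 1) / (fact n * fact (k - 1))"
        using eq by (simp_all add: binomial_fact add.commute del: binomial_Suc_Suc fact_Suc)
      moreover have "k - s = Suc e" "n - i = Suc e"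
        using eq by auto
      ultimately show ?thesis
        by (simp add: mult_ac del: binomial_Suc_Suc fact_Suc)
    qed
    also have "\<dots> = pmf (S_dist k n) i"
      by (rule pmf_S_dist [OF assms(2), symmetric])
    finally show ?thesis .
  next
    case False
    have "i \<notin> ?f ` set_pmf (S_dist n k)"
      using False assms by (auto simp: set_pmf_S_dist)
    moreover have "i \<notin> set_pmf (S_dist k n)"
      using False assms by (auto simp: set_pmf_S_dist)
    ultimately show ?thesis
      by (simp add: pmf_map_outside set_pmf_iff)
  qed
qed

section \<open>Characteristic functions and generating functions\<close>

lemma real_distribution_distr_pmf: "real_distribution (distr (measure_pmf (M :: real pmf)) borel (\<lambda>x. x))"
  unfolding real_distribution_def real_distribution_axioms_def
  by (auto intro!: measure_pmf.prob_space_distr)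

lemma cdf_distr_pmf: "cdf (distr (measure_pmf M) borel (\<lambda>x. x)) = cdf (measure_pmf (M :: real pmf))"
  by (auto simp: cdf_def measure_distr fun_eq_iff)

lemma char_distr_pmf: "char (distr (measure_pmf M) borel (\<lambda>x. x)) = char (measure_pmf (M :: real pmf))"
  by (auto simp: char_def fun_eq_iff integral_distr)

text \<open>\<^const>\<open>measure_pmf\<close> carries the full power set as sigma-algebra, so the continuity theorem
  only applies after restriction to the Borel sets; \<^const>\<open>weak_conv_m\<close> does not see the difference.\<close>

lemma levy_continuity_pmf:
  fixes M :: "nat \<Rightarrow> real pmf"
  assumes "real_distribution \<mu>"
    and "\<And>t. (\<lambda>m. char (measure_pmf (M m)) t) \<longlonglongrightarrow> char \<mu> t"
  shows "weak_conv_m (\<lambda>m. measure_pmf (M m)) \<mu>"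
  using levy_continuity [of "\<lambda>m. distr (measure_pmf (M m)) borel (\<lambda>x. x)" \<mu>] assms
  by (simp add: weak_conv_m_def cdf_distr_pmf char_distr_pmf real_distribution_distr_pmf)

lemma levy_continuity_pmf_pmf:
  fixes M :: "nat \<Rightarrow> real pmf"
  assumes "\<And>t. (\<lambda>m. char (measure_pmf (M m)) t) \<longlonglongrightarrow> char (measure_pmf N) t"
  shows "weak_conv_m (\<lambda>m. measure_pmf (M m)) (measure_pmf N)"
  using levy_continuity_pmf [of "distr (measure_pmf N) borel (\<lambda>x. x)" M] assms
  by (simp add: weak_conv_m_def cdf_distr_pmf char_distr_pmf real_distribution_distr_pmf)

text \<open>Complex arguments serve twice: on the unit circle this is the characteristic function,
  and the complex zeros provide the Bernoulli factors.\<close>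

definition pgf :: "nat pmf \<Rightarrow> complex \<Rightarrow> complex" where
  "pgf M z = (LINT s|measure_pmf M. z ^ s)"

lemma iexp_of_nat: "iexp (t * real s) = iexp t ^ s"
  by (simp add: exp_of_nat_mult [symmetric] mult_ac)

lemma char_map_pmf_real: "char (measure_pmf (map_pmf real M)) t = pgf M (iexp t)"
  by (simp add: char_def pgf_def iexp_of_nat del: of_real_mult)

lemma char_map_pmf_affine:
  "char (measure_pmf (map_pmf (\<lambda>s. (real s - a) / b) M)) t = iexp (- (t / b) * a) * pgf M (iexp (t / b))"
proof -
  have "iexp (t * ((real s - a) / b)) = iexp (- (t / b) * a) * iexp (t / b) ^ s" for s
    unfolding iexp_of_nat [symmetric] exp_add [symmetric] of_real_add [symmetric] distrib_left [symmetric]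
    by (intro arg_cong [where f = exp] arg_cong [where f = "(*) \<i>"] arg_cong [where f = complex_of_real])
      (simp add: algebra_simps diff_divide_distrib)
  then show ?thesis
    by (simp add: char_def pgf_def del: of_real_mult of_real_divide of_real_diff of_real_minus)
qed

lemma pgf_finite:
  assumes "finite A" "set_pmf M \<subseteq> A"
  shows "pgf M z = (\<Sum>s\<in>A. of_real (pmf M s) * z ^ s)"
  unfolding pgf_def
  by (subst integral_measure_pmf [of A]) (use assms in \<open>auto simp: scaleR_conv_of_real\<close>)

lemma pgf_poisson:
  assumes "r > 0"
  shows "pgf (poisson_pmf r) z = exp (of_real r * (z - 1))"
proof -
  let ?f = "\<lambda>s. pmf (poisson_pmf r) s *\<^sub>R z ^ s"
  have f: "?f s = of_real (exp (- r)) * ((of_real r * z) ^ s /\<^sub>R fact s)" for s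
    using assms by (simp add: scaleR_conv_of_real power_mult_distrib field_simps)
  have "summable (\<lambda>s. norm (?f s))"
    unfolding f norm_mult using summable_norm_exp by (intro summable_mult)
  then have "integrable (count_space UNIV) ?f"
    by (simp add: integrable_count_space_nat_iff)
  then have "?f sums (LINT s|count_space UNIV. ?f s)"
    by (rule sums_integral_count_space_nat)
  moreover have "?f sums (of_real (exp (- r)) * exp (of_real r * z))"
    unfolding f by (intro sums_mult exp_converges)
  ultimately have "(LINT s|count_space UNIV. ?f s) = of_real (exp (- r)) * exp (of_real r * z)"
    by (rule sums_unique2)
  also have "\<dots> = exp (of_real r * (z - 1))"
    by (simp add: exp_of_real [symmetric] exp_add [symmetric] algebra_simps)
  finally show ?thesis
    unfolding pgf_def measure_pmf_eq_density by (subst integral_density) auto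
qed

section \<open>Sums of independent Bernoulli variables\<close>

text \<open>A sum of independent Bernoulli variables is encoded by the factorisation of its
  generating function, so no joint probability space has to be built. Finite support makes
  \<open>pgf M\<close> a polynomial.\<close>

definition poisson_binomial :: "nat pmf \<Rightarrow> nat \<Rightarrow> (nat \<Rightarrow> real) \<Rightarrow> bool" where
  "poisson_binomial M d p \<longleftrightarrow> finite (set_pmf M) \<and> (\<forall>i<d. 0 \<le> p i \<and> p i \<le> 1) \<and>
    (\<forall>z. pgf M z = (\<Prod>i<d. 1 - of_real (p i) + of_real (p i) * z))"

text \<open>Nonnegative coefficients exclude positive zeros, so every root is -s with s >= 0.
  Dividing by the value 1 at z = 1 turns its factor into (z + s) / (1 + s), which is Bernoulli with
  parameter 1 / (1 + s).\<close>

lemma poisson_binomial_of_real_rooted: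
  assumes fin: "finite (set_pmf M)" and real: "\<And>z. pgf M z = 0 \<Longrightarrow> z \<in> \<real>"
  obtains d p where "poisson_binomial M d p"
proof -
  define G :: "complex poly" where "G = (\<Sum>s\<in>set_pmf M. monom (of_real (pmf M s)) s)"
  have G: "poly G z = pgf M z" for z
    using pgf_finite [OF fin subset_refl] by (simp add: G_def poly_sum poly_monom)
  have pos: "pgf M (of_real x) \<noteq> 0" if "x > 0" for x
  proof -
    have "pgf M (of_real x) = of_real (\<Sum>s\<in>set_pmf M. pmf M s * x ^ s)"
      by (simp add: pgf_finite [OF fin subset_refl])
    moreover have "(\<Sum>s\<in>set_pmf M. pmf M s * x ^ s) > 0"
      using fin that by (intro sum_pos) (auto simp: set_pmf_not_empty pmf_positive)
    ultimately show ?thesis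
      by (metis of_real_eq_0_iff less_irrefl)
  qed
  have G1: "poly G 1 = 1"
    unfolding G by (simp add: pgf_def)
  then have lc: "lead_coeff G \<noteq> 0"
    by auto
  obtain r where r: "smult (lead_coeff G) (\<Prod>i<degree G. [:- r i, 1:]) = G"
    using complex_poly_decompose' by blast
  define s where "s = (\<lambda>i. - Re (r i))"
  have s: "s i \<ge> 0 \<and> r i = - of_real (s i)" if "i < degree G" for i
  proof -
    have 0: "pgf M (r i) = 0"
      unfolding G [symmetric] using that by (subst r [symmetric]) (auto simp: poly_prod)
    then have "r i = of_real (Re (r i))"
      using real [of "r i"] by (simp add: complex_is_Real_iff complex_eq_iff)
    then show ?thesis
      using 0 pos [of "Re (r i)"] by (fastforce simp: s_def)
  qed
  define p where "p = (\<lambda>i. 1 / (1 + s i))"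
  have P: "pgf M z = lead_coeff G * (\<Prod>i<degree G. z + of_real (s i))" for z
    unfolding G [symmetric] using s by (subst r [symmetric]) (simp add: poly_prod add.commute)
  have "pgf M z = (\<Prod>i<degree G. 1 - of_real (p i) + of_real (p i) * z)" for z
  proof -
    have "pgf M z = pgf M z / pgf M 1"
      using G1 G by simp
    also have "\<dots> = (\<Prod>i<degree G. (z + of_real (s i)) / (1 + of_real (s i)))"
      unfolding P using lc by (simp add: prod_dividef)
    also have "\<dots> = (\<Prod>i<degree G. 1 - of_real (p i) + of_real (p i) * z)"
    proof (intro prod.cong refl)
      fix i assume "i \<in> {..<degree G}"
      then have "1 + s i \<noteq> 0"
        using s [of i] by auto
      then have a: "complex_of_real (1 + s i) \<noteq> 0"
        by (simp only: of_real_eq_0_iff not_False_eq_True)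
      have "complex_of_real (s i) = of_real (1 + s i) - 1" "complex_of_real (p i) = 1 / of_real (1 + s i)"
        by (simp_all add: p_def)
      then show "(z + of_real (s i)) / (1 + of_real (s i)) = 1 - of_real (p i) + of_real (p i) * z"
        using a by (simp add: field_simps del: of_real_add)
    qed
    finally show ?thesis .
  qed
  moreover have "0 \<le> p i \<and> p i \<le> 1" if "i < degree G" for i
    using s [OF that] by (simp add: p_def)
  ultimately have "poisson_binomial M (degree G) p"
    using fin by (simp add: poisson_binomial_def)
  then show ?thesis
    using that by blast
qed

text \<open>Derivatives at 1 are factorial moments; the second is the sum of p_i p_j over ordered
  pairs of distinct indices.\<close>

lemma pderiv_bernoulli_product:
  fixes p :: "nat \<Rightarrow> 'a::field_char_0"
  defines "L \<equiv> \<lambda>d. \<Prod>i<d. [:1 - p i, p i:]"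
  shows "poly (L d) 1 = 1" and "poly (pderiv (L d)) 1 = (\<Sum>i<d. p i)"
    and "poly (pderiv (pderiv (L d))) 1 = (\<Sum>i<d. p i)\<^sup>2 - (\<Sum>i<d. (p i)\<^sup>2)"
proof -
  have S: "L (Suc d) = L d * [:1 - p d, p d:]" for d
    by (simp add: L_def)
  note [simp del] = mult_pCons_left mult_pCons_right
  show 1: "poly (L d) 1 = 1" for d
    by (simp add: L_def poly_prod)
  have D: "pderiv (L (Suc d)) = pderiv (L d) * [:1 - p d, p d:] + L d * [:p d:]" for d
    by (simp add: S pderiv_mult pderiv_pCons algebra_simps)
  have D2: "pderiv (pderiv (L (Suc d))) =
      pderiv (pderiv (L d)) * [:1 - p d, p d:] + pderiv (L d) * [:2 * p d:]" for d
    unfolding D by (simp add: pderiv_add pderiv_mult pderiv_pCons poly_eq_poly_eq_iff [symmetric] fun_eq_iff algebra_simps)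
  show 2: "poly (pderiv (L d)) 1 = (\<Sum>i<d. p i)" for d
  proof (induction d)
    case 0
    then show ?case by (simp add: L_def)
  next
    case (Suc d)
    then show ?case by (simp add: D 1)
  qed
  show "poly (pderiv (pderiv (L d))) 1 = (\<Sum>i<d. p i)\<^sup>2 - (\<Sum>i<d. (p i)\<^sup>2)"
  proof (induction d)
    case 0
    then show ?case by (simp add: L_def)
  next
    case (Suc d)
    then show ?case by (simp add: D2 2 power2_eq_square algebra_simps)
  qed
qed

lemma poisson_binomial_moments:
  assumes "poisson_binomial M d p"
  shows "measure_pmf.expectation M real = (\<Sum>i<d. p i)"
    and "measure_pmf.expectation M (\<lambda>s. real s * (real s - 1)) = (\<Sum>i<d. p i)\<^sup>2 - (\<Sum>i<d. (p i)\<^sup>2)"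
    and "measure_pmf.variance M real = (\<Sum>i<d. p i * (1 - p i))"
proof -
  have fin: "finite (set_pmf M)"
    and pgf: "\<And>z. pgf M z = (\<Prod>i<d. 1 - of_real (p i) + of_real (p i) * z)"
    using assms by (auto simp: poisson_binomial_def)
  let ?G = "(\<Sum>s\<in>set_pmf M. monom (of_real (pmf M s)) s) :: complex poly"
  let ?L = "\<Prod>i<d. [:1 - of_real (p i), of_real (p i):] :: complex poly"
  have "poly ?G z = poly ?L z" for z
    using pgf_finite [OF fin subset_refl, of z] pgf [of z]
    by (simp add: poly_sum poly_monom poly_prod mult.commute)
  then have GL: "?G = ?L"
    by (simp add: poly_eq_poly_eq_iff [symmetric] fun_eq_iff)
  have S: "pderiv (sum f A) = (\<Sum>x\<in>A. pderiv (f x))" for f :: "nat \<Rightarrow> complex poly" and A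
    using higher_pderiv_sum [of 1 f A] by simp
  have "of_real (measure_pmf.expectation M real) = poly (pderiv ?G) 1"
    by (simp add: integral_measure_pmf_real [OF fin] S pderiv_monom poly_sum poly_monom)
  also have "\<dots> = of_real (\<Sum>i<d. p i)"
    unfolding GL by (simp add: pderiv_bernoulli_product)
  finally show 1: "measure_pmf.expectation M real = (\<Sum>i<d. p i)"
    by (simp only: of_real_eq_iff)
  have "of_real (measure_pmf.expectation M (\<lambda>s. real s * (real s - 1))) = poly (pderiv (pderiv ?G)) 1"
  proof -
    \<comment> \<open>Differentiating monomials produces the truncated \<open>s - Suc 0\<close>; at
      \<open>s = 0\<close> the factor \<open>of_nat s\<close> makes both sides 0.\<close>
    have eq: "of_nat s * (of_nat s - 1) * c = of_nat (s - Suc 0) * of_nat s * c" for s and c :: complex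
      by (cases s) auto
    show ?thesis
      by (simp add: integral_measure_pmf_real [OF fin] S pderiv_monom poly_sum poly_monom
          mult.assoc [symmetric], intro sum.cong refl eq)
  qed
  also have "\<dots> = of_real ((\<Sum>i<d. p i)\<^sup>2 - (\<Sum>i<d. (p i)\<^sup>2))"
    unfolding GL by (simp add: pderiv_bernoulli_product)
  finally show 2: "measure_pmf.expectation M (\<lambda>s. real s * (real s - 1)) = (\<Sum>i<d. p i)\<^sup>2 - (\<Sum>i<d. (p i)\<^sup>2)"
    by (simp only: of_real_eq_iff)
  have int: "integrable (measure_pmf M) f" for f :: "nat \<Rightarrow> real"
    by (rule integrable_measure_pmf_finite [OF fin])
  have "measure_pmf.variance M real =
      measure_pmf.expectation M (\<lambda>s. real s * (real s - 1) + real s) - (measure_pmf.expectation M real)\<^sup>2"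
    by (subst measure_pmf.variance_eq) (auto simp: int power2_eq_square algebra_simps)
  also have "\<dots> = (\<Sum>i<d. p i * (1 - p i))"
    unfolding Bochner_Integration.integral_add [OF int int] 1 2
    by (simp add: sum_subtractf power2_eq_square algebra_simps)
  finally show "measure_pmf.variance M real = (\<Sum>i<d. p i * (1 - p i))" .
qed

text \<open>The bound 2 is chosen for u = p (z - 1) with 0 <= p <= 1 and z in the closed unit
  disc.\<close>

lemma norm_exp_minus_linear_le:
  fixes u :: complex
  assumes "norm u \<le> 2"
  shows "norm (1 + u - exp u) \<le> exp 2 * (norm u)\<^sup>2"
proof -
  have "norm (1 + u - exp u) = norm (exp u - (1 + u))"
    by (rule norm_minus_commute)
  also have "\<dots> \<le> exp (norm u) * (norm u)\<^sup>2"
    using Taylor_exp_field [of u 1] by (simp add: numeral_2_eq_2)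
  also have "\<dots> \<le> exp 2 * (norm u)\<^sup>2"
    using assms by (intro mult_right_mono) auto
  finally show ?thesis .
qed

text \<open>The factors 1 + p (z - 1) and exp (p (z - 1)) all lie in the closed unit disc, so the
  products differ by at most the sum of the factorwise differences. Each of these is at most exp 2
  (2 p)^2, as |z - 1| <= 2.\<close>

lemma poisson_binomial_poisson_approx:
  assumes pb: "poisson_binomial M d p" and z: "norm z \<le> 1"
  shows "norm (pgf M z - exp (of_real (measure_pmf.expectation M real) * (z - 1))) \<le>
    4 * exp 2 * (measure_pmf.expectation M real - measure_pmf.variance M real)"
proof -
  have p: "0 \<le> p i \<and> p i \<le> 1" if "i < d" for i
    using pb that by (auto simp: poisson_binomial_def)
  have z2: "norm (z - 1) \<le> 2"
    using norm_triangle_ineq4 [of z 1] z by simp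
  let ?z = "\<lambda>i. 1 - of_real (p i) + of_real (p i) * z"
  let ?w = "\<lambda>i. exp (of_real (p i) * (z - 1))"
  have nz: "norm (?z i) \<le> 1" if "i < d" for i
  proof -
    have "norm (?z i) \<le> norm (of_real (1 - p i) :: complex) + norm (of_real (p i) * z)"
      using norm_triangle_ineq [of "of_real (1 - p i) :: complex" "of_real (p i) * z"] by simp
    also have "\<dots> \<le> (1 - p i) + p i * 1"
      unfolding norm_mult norm_of_real using p [OF that] z
      by (intro add_mono mult_mono) auto
    finally show ?thesis by simp
  qed
  have nw: "norm (?w i) \<le> 1" if "i < d" for i
    using p [OF that] z complex_Re_le_cmod [of z] by (simp add: mult_nonneg_nonpos)
  have "pgf M z = (\<Prod>i<d. ?z i)"
    using pb by (simp add: poisson_binomial_def)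
  moreover have "exp (of_real (measure_pmf.expectation M real) * (z - 1)) = (\<Prod>i<d. ?w i)"
    by (simp add: poisson_binomial_moments [OF pb] exp_sum sum_distrib_right)
  ultimately have "norm (pgf M z - exp (of_real (measure_pmf.expectation M real) * (z - 1))) \<le>
      (\<Sum>i<d. norm (?z i - ?w i))"
    using norm_prod_diff [of "{..<d}" ?z ?w] nz nw by simp
  also have "\<dots> \<le> (\<Sum>i<d. 4 * exp 2 * (p i)\<^sup>2)"
  proof (intro sum_mono)
    fix i assume "i \<in> {..<d}"
    then have pi: "0 \<le> p i" "p i \<le> 1" using p by auto
    let ?u = "of_real (p i) * (z - 1)"
    have u: "norm ?u \<le> p i * 2"
      unfolding norm_mult norm_of_real using pi z2 by (intro mult_mono) auto
    have "norm (?z i - ?w i) = norm (1 + ?u - exp ?u)"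
      by (simp add: algebra_simps)
    also have "\<dots> \<le> exp 2 * (norm ?u)\<^sup>2"
      using u pi by (intro norm_exp_minus_linear_le) linarith
    also have "\<dots> \<le> exp 2 * (p i * 2)\<^sup>2"
      using u by (intro mult_left_mono power_mono) auto
    finally show "norm (?z i - ?w i) \<le> 4 * exp 2 * (p i)\<^sup>2"
      by (simp add: power_mult_distrib)
  qed
  also have "\<dots> = 4 * exp 2 * ((\<Sum>i<d. p i) - (\<Sum>i<d. p i * (1 - p i)))"
    by (simp add: sum_distrib_left sum_subtractf [symmetric] power2_eq_square algebra_simps)
  also have "(\<Sum>i<d. p i) - (\<Sum>i<d. p i * (1 - p i)) =
      measure_pmf.expectation M real - measure_pmf.variance M real"
    by (rule arg_cong2 [where f = "(-)", OF poisson_binomial_moments(1,3) [OF pb, symmetric]])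
  finally show ?thesis .
qed

lemma exp_minus_bounds:
  fixes x :: real
  assumes "x \<ge> 0"
  shows "\<bar>exp (- x) - (1 - x)\<bar> \<le> x\<^sup>2"
proof -
  have "exp (- x) \<ge> 1 - x"
    using exp_ge_add_one_self [of "- x"] by simp
  moreover have "exp (- x) \<le> 1 - x + x\<^sup>2"
  proof -
    have "exp (- x) = 1 / exp x"
      by (simp add: exp_minus divide_inverse)
    also have "\<dots> \<le> 1 / (1 + x)"
      using assms exp_ge_add_one_self [of x] by (intro divide_left_mono) auto
    \<comment> \<open>(1 + x) (1 - x + x^2) = 1 + x^3 >= 1.\<close>
    also have "\<dots> \<le> 1 - x + x\<^sup>2"
      using assms by (simp add: field_simps power2_eq_square)
    finally show ?thesis .
  qed
  ultimately show ?thesis by simp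
qed

text \<open>The first term is the characteristic function at \<open>u\<close> of a centred Bernoulli
  variable. The point of the bound is its factor p (1 - p), which sums to the variance; the cubic
  remainders keep it since (1 - p) p^3 + p (1 - p)^3 = p (1 - p) (p^2 + (1 - p)^2).\<close>

lemma bernoulli_char_approx:
  assumes p: "0 \<le> p" "p \<le> 1"
  shows "cmod (iexp (- u * p) * (1 - of_real p + of_real p * iexp u) - of_real (exp (- (p * (1 - p) * u\<^sup>2 / 2))))
    \<le> p * (1 - p) * (\<bar>u\<bar> ^ 3 + u ^ 4)"
proof -
  define E where "E = (\<lambda>x. iexp x - (1 + \<i> * of_real x - of_real (x\<^sup>2) / 2))"
  have E: "cmod (E x) \<le> \<bar>x\<bar> ^ 3" for x
  proof -
    have "cmod (E x) \<le> \<bar>x\<bar> ^ 3 / 6"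
      using iexp_approx1 [of x 2]
      by (simp add: E_def eval_nat_numeral field_simps)
    also have "\<dots> \<le> \<bar>x\<bar> ^ 3" by simp
    finally show ?thesis .
  qed
  let ?v = "p * (1 - p)"
  have v: "0 \<le> ?v" "?v \<le> 1"
    using p mult_le_one [of p "1 - p"] by auto
  have x: "iexp (- u * p) * iexp u = iexp (u * (1 - p))"
    unfolding exp_add [symmetric] by (simp add: algebra_simps)
  have "iexp (- u * p) * (1 - of_real p + of_real p * iexp u) =
      of_real (1 - p) * iexp (- u * p) + of_real p * (iexp (- u * p) * iexp u)"
    by (simp add: algebra_simps)
  also have "\<dots> = of_real (1 - p) * (E (- u * p) + (1 + \<i> * of_real (- u * p) - of_real ((- u * p)\<^sup>2) / 2))
      + of_real p * (E (u * (1 - p)) + (1 + \<i> * of_real (u * (1 - p)) - of_real ((u * (1 - p))\<^sup>2) / 2))"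
    unfolding x by (simp add: E_def)
  \<comment> \<open>By centring, the linear terms cancel; the quadratic ones combine through (1 - p)
    p^2 + p (1 - p)^2 = p (1 - p).\<close>
  also have "\<dots> = of_real (1 - p) * E (- u * p) + of_real p * E (u * (1 - p)) + of_real (1 - ?v * u\<^sup>2 / 2)"
    by (simp add: power2_eq_square field_simps)
  finally have eq: "iexp (- u * p) * (1 - of_real p + of_real p * iexp u) - of_real (exp (- (?v * u\<^sup>2 / 2))) =
      of_real (1 - p) * E (- u * p) + of_real p * E (u * (1 - p)) -
      of_real (exp (- (?v * u\<^sup>2 / 2)) - (1 - ?v * u\<^sup>2 / 2))"
    by simp
  have e1: "cmod (of_real (1 - p) * E (- u * p)) \<le> (1 - p) * \<bar>- u * p\<bar> ^ 3"
    unfolding norm_mult norm_of_real using p E [of "- u * p"] by (intro mult_mono) auto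
  have e2: "cmod (of_real p * E (u * (1 - p))) \<le> p * \<bar>u * (1 - p)\<bar> ^ 3"
    unfolding norm_mult norm_of_real using p E [of "u * (1 - p)"] by (intro mult_mono) auto
  have e3: "cmod (of_real (exp (- (?v * u\<^sup>2 / 2)) - (1 - ?v * u\<^sup>2 / 2))) \<le> (?v * u\<^sup>2 / 2)\<^sup>2"
    unfolding norm_of_real using v by (intro exp_minus_bounds) auto
  have "\<bar>- u * p\<bar> = \<bar>u\<bar> * p" "\<bar>u * (1 - p)\<bar> = \<bar>u\<bar> * (1 - p)"
    using p by (simp_all add: abs_mult)
  then have "(1 - p) * \<bar>- u * p\<bar> ^ 3 + p * \<bar>u * (1 - p)\<bar> ^ 3 = ?v * \<bar>u\<bar> ^ 3 * (p\<^sup>2 + (1 - p)\<^sup>2)"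
    by (simp only:) (simp add: power2_eq_square power3_eq_cube algebra_simps)
  also have "\<dots> \<le> ?v * \<bar>u\<bar> ^ 3 * 1"
  proof (intro mult_left_mono)
    have "p\<^sup>2 + (1 - p)\<^sup>2 = 1 - 2 * ?v"
      by (simp add: power2_eq_square algebra_simps)
    then show "p\<^sup>2 + (1 - p)\<^sup>2 \<le> 1" using v by simp
  qed (use v in auto)
  finally have e12: "(1 - p) * \<bar>- u * p\<bar> ^ 3 + p * \<bar>u * (1 - p)\<bar> ^ 3 \<le> ?v * \<bar>u\<bar> ^ 3"
    by simp
  have "(?v * u\<^sup>2 / 2)\<^sup>2 = ?v * (?v * u ^ 4 / 4)"
    by (simp add: power2_eq_square eval_nat_numeral)
  also have "\<dots> \<le> ?v * (1 * u ^ 4)"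
  proof (intro mult_left_mono)
    have "?v * u ^ 4 \<le> 1 * u ^ 4"
      using v by (intro mult_right_mono) auto
    moreover have "u ^ 4 \<ge> 0" by simp
    ultimately show "?v * u ^ 4 / 4 \<le> 1 * u ^ 4" by linarith
  qed (use v in auto)
  finally have "(?v * u\<^sup>2 / 2)\<^sup>2 \<le> ?v * u ^ 4"
    by simp
  with e1 e2 e3 e12 show ?thesis
    unfolding eq distrib_left [of ?v]
    by (intro order_trans [OF norm_triangle_ineq4] order_trans [OF add_right_mono [OF norm_triangle_ineq]]) linarith
qed

text \<open>As \<open>\<sigma>2\<close> is the sum of the p_i (1 - p_i), the Gaussian factor splits
  into one factor per Bernoulli variable at u = t / sqrt \<open>\<sigma>2\<close>. The errors add up
  to \<open>\<sigma>2\<close> times |u|^3 + u^4, which is small as soon as \<open>\<sigma>2\<close>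
  is large.\<close>

lemma poisson_binomial_normal_approx:
  assumes pb: "poisson_binomial M d p"
    and mu: "\<mu> = measure_pmf.expectation M real"
    and sigma: "\<sigma>2 = measure_pmf.variance M real" "\<sigma>2 > 0"
  shows "cmod (char (measure_pmf (map_pmf (\<lambda>s. (real s - \<mu>) / sqrt \<sigma>2) M)) t - of_real (exp (- (t\<^sup>2 / 2)))) \<le>
    \<bar>t\<bar> ^ 3 * sqrt (1 / \<sigma>2) + t ^ 4 * (1 / \<sigma>2)"
proof -
  define u where "u = t / sqrt \<sigma>2"
  have p: "0 \<le> p i \<and> p i \<le> 1" if "i < d" for i
    using pb that by (auto simp: poisson_binomial_def)
  let ?z = "\<lambda>i. iexp (- u * p i) * (1 - of_real (p i) + of_real (p i) * iexp u)"
  let ?w = "\<lambda>i. complex_of_real (exp (- (p i * (1 - p i) * u\<^sup>2 / 2)))"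
  have var: "\<sigma>2 = (\<Sum>i<d. p i * (1 - p i))"
    unfolding sigma(1) by (rule poisson_binomial_moments(3) [OF pb])
  have nz: "cmod (?z i) \<le> 1" if "i < d" for i
  proof -
    have "cmod (?z i) = cmod (of_real (1 - p i) + of_real (p i) * iexp u)"
      by (simp add: norm_mult del: of_real_mult of_real_minus)
    also have "\<dots> \<le> cmod (of_real (1 - p i)) + cmod (of_real (p i) * iexp u)"
      by (rule norm_triangle_ineq)
    also have "\<dots> = 1"
      unfolding norm_mult norm_of_real using p [OF that] by simp
    finally show ?thesis .
  qed
  have nw: "cmod (?w i) \<le> 1" if "i < d" for i
    using p [OF that] by simp
  have "iexp (- u * \<mu>) = (\<Prod>i<d. iexp (- u * p i))"
    unfolding exp_sum [OF finite_lessThan, symmetric] of_real_sum [symmetric] sum_distrib_left [symmetric]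
    by (simp add: mu poisson_binomial_moments [OF pb])
  then have 1: "char (measure_pmf (map_pmf (\<lambda>s. (real s - \<mu>) / sqrt \<sigma>2) M)) t = (\<Prod>i<d. ?z i)"
    using pb unfolding char_map_pmf_affine u_def poisson_binomial_def
    by (simp only: prod.distrib minus_divide_left)
  have "t\<^sup>2 / 2 = \<sigma>2 * u\<^sup>2 / 2"
    using sigma by (simp add: u_def power_divide)
  then have "- (t\<^sup>2 / 2) = (\<Sum>i<d. - (p i * (1 - p i) * u\<^sup>2 / 2))"
    unfolding var by (simp add: sum_negf sum_distrib_right sum_divide_distrib)
  then have 2: "of_real (exp (- (t\<^sup>2 / 2))) = (\<Prod>i<d. ?w i)"
    by (simp only: exp_sum [OF finite_lessThan] of_real_prod)
  have "cmod (char (measure_pmf (map_pmf (\<lambda>s. (real s - \<mu>) / sqrt \<sigma>2) M)) t - of_real (exp (- (t\<^sup>2 / 2)))) \<le>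
      (\<Sum>i<d. cmod (?z i - ?w i))"
    unfolding 1 2 using nz nw by (intro norm_prod_diff) auto
  also have "\<dots> \<le> (\<Sum>i<d. p i * (1 - p i) * (\<bar>u\<bar> ^ 3 + u ^ 4))"
    using p by (intro sum_mono bernoulli_char_approx) auto
  also have "\<dots> = \<sigma>2 * (\<bar>u\<bar> ^ 3 + u ^ 4)"
    by (simp add: var sum_distrib_right)
  also have "\<dots> = \<bar>t\<bar> ^ 3 * sqrt (1 / \<sigma>2) + t ^ 4 * (1 / \<sigma>2)"
  proof -
    define s where "s = sqrt \<sigma>2"
    have s: "s > 0" "\<sigma>2 = s\<^sup>2" using sigma(2) by (simp_all add: s_def)
    have u: "u = t / s" "sqrt (1 / \<sigma>2) = 1 / s"
      by (simp_all add: u_def s_def real_sqrt_divide)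
    show ?thesis
      unfolding u using s by (simp add: field_simps eval_nat_numeral)
  qed
  finally show ?thesis .
qed

section \<open>Moments\<close>

text \<open>C(b,j) C(j,r) = C(b,r) C(b-r,j-r) reduces the binomial moment to Vandermonde's
  identity.\<close>

lemma sum_choose_hypergeometric:
  assumes "r \<le> c"
  shows "(\<Sum>j\<le>c. (j choose r) * ((b choose j) * (a choose (c - j)))) =
    (b choose r) * ((b - r + a) choose (c - r))"
proof (cases "r \<le> b")
  case True
  have "(\<Sum>j\<le>c. (j choose r) * ((b choose j) * (a choose (c - j)))) =
      (\<Sum>j=r..c. (j choose r) * ((b choose j) * (a choose (c - j))))"
    by (intro sum.mono_neutral_right) (auto simp: binomial_eq_0)
  also have "\<dots> = (\<Sum>i\<le>c - r. ((i + r) choose r) * ((b choose (i + r)) * (a choose (c - (i + r)))))"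
    using assms by (intro sum.reindex_bij_witness [of _ "\<lambda>i. i + r" "\<lambda>j. j - r"]) auto
  also have "\<dots> = (\<Sum>i\<le>c - r. (b choose r) * (((b - r) choose i) * (a choose (c - r - i))))"
  proof (intro sum.cong refl)
    fix i
    have "(b choose (i + r)) * ((i + r) choose r) = (b choose r) * ((b - r) choose i)"
    proof (cases "i + r \<le> b")
      case True
      then show ?thesis using choose_mult [of r "i + r" b] by simp
    next
      case False
      then show ?thesis using \<open>r \<le> b\<close> by (simp add: binomial_eq_0)
    qed
    moreover have "c - (i + r) = c - r - i" by simp
    ultimately show "((i + r) choose r) * ((b choose (i + r)) * (a choose (c - (i + r)))) =
        (b choose r) * (((b - r) choose i) * (a choose (c - r - i)))"
      by (metis mult.assoc mult.commute)
  qed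
  also have "\<dots> = (b choose r) * ((b - r + a) choose (c - r))"
    by (simp only: sum_distrib_left [symmetric] vandermonde)
  finally show ?thesis .
next
  case False
  then have "j < r \<or> b < j" for j
    by linarith
  then have "(j choose r) * (b choose j) = 0" for j
    by (metis binomial_eq_0 mult_is_0)
  then have "(\<Sum>j\<le>c. (j choose r) * ((b choose j) * (a choose (c - j)))) = 0"
    by auto
  then show ?thesis using False by (simp add: binomial_eq_0)
qed

lemma expectation_S_dist_choose:
  assumes "n > 0" "r \<le> k"
  shows "measure_pmf.expectation (S_dist n k) (\<lambda>s. real (s choose r)) =
    real ((k - 1) choose r) * real ((k - 1 - r + n) choose (k - r)) / real ((n + k - 1) choose k)"
proof -
  have "measure_pmf.expectation (S_dist n k) (\<lambda>s. real (s choose r)) =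
      (\<Sum>j\<le>k. real (j choose r) * pmf (S_dist n k) j)"
    using assms by (intro integral_measure_pmf_real) (auto simp: set_pmf_S_dist)
  also have "\<dots> = real (\<Sum>j\<le>k. (j choose r) * (((k - 1) choose j) * (n choose (k - j)))) /
      real ((n + k - 1) choose k)"
    using assms by (simp add: pmf_S_dist sum_divide_distrib mult_ac)
  finally show ?thesis
    by (simp add: sum_choose_hypergeometric assms)
qed

lemma S_dist_moments:
  assumes "n > 0"
  shows "measure_pmf.expectation (S_dist n k) real = real k * (real k - 1) / (real n + real k - 1)" (is ?A)
    and "measure_pmf.expectation (S_dist n k) (\<lambda>s. real s * (real s - 1)) =
      real k * (real k - 1)\<^sup>2 * (real k - 2) / ((real n + real k - 1) * (real n + real k - 2))" (is ?B)
proof -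
  have "?A \<and> ?B"
  proof (cases "k \<le> 1")
    \<comment> \<open>No ties are possible here, and both numerators vanish, so the formulas give 0
      even where a denominator is 0.\<close>
    case True
    have "set_pmf (S_dist n k) \<subseteq> {0}"
      using True assms by (auto simp: set_pmf_S_dist)
    then have "measure_pmf.expectation (S_dist n k) f = f 0 * pmf (S_dist n k) 0" for f :: "nat \<Rightarrow> real"
      by (subst integral_measure_pmf_real [of "{0}"]) auto
    then show ?thesis
      using True by (cases k) auto
  next
    case False
    then obtain j where k: "k = Suc (Suc j)"
      by (metis One_nat_def Suc_le_mono le0 not0_implies_Suc)
    obtain m where n: "n = Suc m"
      using assms gr0_implies_Suc by blast
    define C where "C = real ((n + k - 1) choose k)"
    have C: "C > 0"
      using assms by (simp add: C_def)
    \<comment> \<open>\<open>1\<close> and \<open>2\<close> are absorption, leading from C(n+k-1,k)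
      to C(n+k-2,k-1) and on to C(n+k-3,k-2), the binomials of the first and second moment.\<close>
    have 1: "real k * C = (real n + real k - 1) * real ((j + n) choose Suc j)"
      using Suc_times_binomial [of "Suc j" "j + n", THEN arg_cong [where f = real]]
      by (simp only: k n C_def of_nat_mult) (simp add: algebra_simps)
    have 2: "real (Suc j) * real ((j + n) choose Suc j) = real (j + n) * real ((j + m) choose j)"
      using Suc_times_binomial [of j "j + m", THEN arg_cong [where f = real]]
      by (simp only: n of_nat_mult add_Suc_right)
    have A: ?A
    proof -
      have "measure_pmf.expectation (S_dist n k) (\<lambda>s. real (s choose 1)) =
          real (Suc j) * real ((j + n) choose Suc j) / C"
        using expectation_S_dist_choose [OF assms, of 1 k] k by (simp add: C_def)
      also have "\<dots> = real (Suc j) * (real ((j + n) choose Suc j) / C)"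
        by simp
      also have "real ((j + n) choose Suc j) / C = real k / (real n + real k - 1)"
        using 1 C k assms by (simp add: field_simps)
      finally show ?thesis
        by (simp add: k mult.commute)
    qed
    have B: ?B
    proof -
      have c2: "real s * (real s - 1) = 2 * real (s choose 2)" for s
      proof -
        have "2 * (s choose 2) = s * (s - 1)"
          unfolding choose_two by (rule dvd_mult_div_cancel) (cases s; simp)
        then have "2 * real (s choose 2) = real (s * (s - 1))"
          by (metis of_nat_mult of_nat_numeral)
        then show ?thesis by (cases s) (auto simp: algebra_simps)
      qed
      have "measure_pmf.expectation (S_dist n k) (\<lambda>s. real s * (real s - 1)) =
          2 * measure_pmf.expectation (S_dist n k) (\<lambda>s. real (s choose 2))"
        by (simp add: c2)
      also have "\<dots> = (2 * real (Suc j choose 2)) * real ((Suc j - 2 + n) choose j) / C"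
        using expectation_S_dist_choose [OF assms, of 2 k] k by (simp add: C_def)
      \<comment> \<open>At \<open>j = 0\<close> the difference \<open>Suc j - 2\<close> is
        truncated, but the prefactor is 0.\<close>
      also have "\<dots> = (real (Suc j) * real j) * real ((j + m) choose j) / C"
        using c2 [of "Suc j"] by (cases j) (simp_all add: n)
      also have "real ((j + m) choose j) = real (Suc j) * real ((j + n) choose Suc j) / real (j + n)"
        using 2 assms by (simp add: field_simps)
      also have "real ((j + n) choose Suc j) = real k * C / (real n + real k - 1)"
        using 1 k assms by (simp add: field_simps)
      also have "(real (Suc j) * real j) * (real (Suc j) * (real k * C / (real n + real k - 1)) / real (j + n)) / C =
          real k * (real k - 1)\<^sup>2 * (real k - 2) / ((real n + real k - 1) * (real n + real k - 2))"
        using C by (simp add: k power2_eq_square mult_ac add_ac)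
      finally show ?thesis .
    qed
    show ?thesis using A B by simp
  qed
  then show ?A ?B by auto
qed

text \<open>Real-rootedness is applied with a = n, b = k - 1, c = k; its degree condition
  \<open>k \<le> n + (k - 1)\<close> follows from \<open>n > 0\<close>.\<close>

lemma poisson_binomial_S_dist:
  assumes "n > 0"
  obtains d p where "poisson_binomial (S_dist n k) d p"
proof (rule poisson_binomial_of_real_rooted)
  have sub: "set_pmf (S_dist n k) \<subseteq> {..k}"
    using assms by (auto simp: set_pmf_S_dist)
  then show "finite (set_pmf (S_dist n k))"
    using finite_subset by blast
  fix z assume "pgf (S_dist n k) z = 0"
  moreover have "pgf (S_dist n k) z =
      (\<Sum>j\<le>k. of_nat (n choose (k - j)) * of_nat ((k - 1) choose j) * z ^ j) /
        of_nat ((n + k - 1) choose k)"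
    using assms by (simp add: pgf_finite [OF _ sub] pmf_S_dist sum_divide_distrib)
  moreover have "(n + k - 1) choose k \<noteq> 0"
    using assms by simp
  ultimately have "(\<Sum>j\<le>k. of_nat (n choose (k - j)) * of_nat ((k - 1) choose j) * z ^ j) = 0"
    by (metis divide_eq_0_iff of_nat_eq_0_iff)
  then show "z \<in> \<real>"
    by (rule hypergeometric_real_rooted [rotated]) (use assms in linarith)
qed

lemma S_var_eq:
  assumes "n > 0"
  shows "S_var n k = S_mean n k + measure_pmf.expectation (S_dist n k) (\<lambda>s. real s * (real s - 1)) - (S_mean n k)\<^sup>2"
proof -
  obtain d p where pb: "poisson_binomial (S_dist n k) d p"
    using poisson_binomial_S_dist assms by blast
  have "S_var n k = (\<Sum>i<d. p i * (1 - p i))"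
    unfolding S_var_def by (rule poisson_binomial_moments(3) [OF pb])
  then show ?thesis
    unfolding S_mean_def poisson_binomial_moments(1,2) [OF pb]
    by (simp add: sum_subtractf power2_eq_square algebra_simps)
qed

lemma S_var_formula:
  assumes "n > 0" "k > 1"
  shows "S_var n k = real n * (real n - 1) * real k * (real k - 1) /
    ((real n + real k - 1)\<^sup>2 * (real n + real k - 2))"
proof -
  \<comment> \<open>Used with x = k, y = k - 1 and N = n + k - 1, so that N - y = n; the bounds on n
    and k give N > 1.\<close>
  have *: "x * y / N + x * y\<^sup>2 * (x - 2) / (N * (N - 1)) - (x * y / N)\<^sup>2 =
      (N - y) * (N - y - 1) * x * y / (N\<^sup>2 * (N - 1))"
    if "y = x - 1" "N \<noteq> 0" "N \<noteq> 1" for x y N :: real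
    using that by (simp add: divide_simps) (simp add: power2_eq_square algebra_simps)
  have "real n + real k - 1 \<noteq> 0" "real n + real k - 1 \<noteq> 1"
    using assms by auto
  from * [OF refl this, of "real k"] show ?thesis
    unfolding S_var_eq [OF assms(1)] S_mean_def S_dist_moments [OF assms(1)]
    by (simp add: algebra_simps)
qed

text \<open>The 16 is 4 * 4: one 4 from (x + y)^3 <= 4 (x^3 + y^3), the other from x - 1 >= x / 2
  and y - 1 >= y / 2.\<close>

lemma S_var_lower_bound:
  assumes "n > 1" "k > 1"
  shows "S_var n k > 0"
    and "1 / S_var n k \<le> 16 * (real n / (real k)\<^sup>2 + real k / (real n)\<^sup>2)"
proof -
  define x y where "x = real n" and "y = real k"
  have xy: "x \<ge> 2" "y \<ge> 2"
    using assms by (auto simp: x_def y_def)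
  have V: "S_var n k = x * (x - 1) * y * (y - 1) / ((x + y - 1)\<^sup>2 * (x + y - 2))"
    using S_var_formula [of n k] assms by (simp add: x_def y_def)
  then show pos: "S_var n k > 0"
    using xy by simp
  have "(x + y - 1)\<^sup>2 * (x + y - 2) \<le> (x + y)\<^sup>2 * (x + y)"
    using xy by (intro mult_mono power_mono) auto
  also have "\<dots> \<le> 4 * (x ^ 3 + y ^ 3)"
  proof -
    have "4 * (x ^ 3 + y ^ 3) - (x + y)\<^sup>2 * (x + y) = 3 * (x + y) * (x - y)\<^sup>2"
      by (simp add: power2_eq_square power3_eq_cube algebra_simps)
    also have "\<dots> \<ge> 0" using xy by simp
    finally show ?thesis by simp
  qed
  finally have D: "(x + y - 1)\<^sup>2 * (x + y - 2) \<le> 4 * (x ^ 3 + y ^ 3)" .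
  have N: "x * (x / 2) * y * (y / 2) \<le> x * (x - 1) * y * (y - 1)"
    using xy by (intro mult_mono) auto
  have "1 / S_var n k = (x + y - 1)\<^sup>2 * (x + y - 2) / (x * (x - 1) * y * (y - 1))"
    by (simp add: V)
  also have "\<dots> \<le> 4 * (x ^ 3 + y ^ 3) / (x * (x / 2) * y * (y / 2))"
    using xy by (intro frac_le D N) auto
  also have "\<dots> = 16 * (x / y\<^sup>2 + y / x\<^sup>2)"
    using xy by (simp add: field_simps power2_eq_square power3_eq_cube)
  finally show "1 / S_var n k \<le> 16 * (real n / (real k)\<^sup>2 + real k / (real n)\<^sup>2)"
    by (simp add: x_def y_def)
qed

section \<open>Limit laws\<close>

text \<open>After division by n the shifts \<open>a\<close>, \<open>b\<close>, \<open>d\<close> only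
  meet k / n and 1 / n, which tend to 0. Free shifts let it serve both for E and for the ratio (k -
  1) (k - 2) / (n + k - 2), the factor by which E is multiplied to give E(S(S-1)).\<close>

lemma tendsto_quadratic_ratio:
  fixes n k :: "nat \<Rightarrow> nat" and a b d c :: real
  assumes n: "filterlim n at_top sequentially"
    and k: "(\<lambda>m. real (k m) / sqrt (real (n m))) \<longlonglongrightarrow> c"
  shows "(\<lambda>m. (real (k m) - a) * (real (k m) - b) / (real (n m) + real (k m) - d)) \<longlonglongrightarrow> c\<^sup>2"
proof -
  have n': "filterlim (\<lambda>m. real (n m)) at_top sequentially"
    by (rule filterlim_compose [OF filterlim_real_sequentially n])
  have i: "(\<lambda>m. 1 / real (n m)) \<longlonglongrightarrow> 0"
    by (rule tendsto_divide_0 [OF tendsto_const filterlim_at_top_imp_at_infinity [OF n']])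
  have r: "(\<lambda>m. sqrt (1 / real (n m))) \<longlonglongrightarrow> 0"
    using tendsto_real_sqrt [OF i] by simp
  have lin: "(\<lambda>m. real (k m) / sqrt (real (n m)) * sqrt (1 / real (n m))) \<longlonglongrightarrow> 0"
    using tendsto_mult [OF k r] by simp
  have "(\<lambda>m. ((real (k m) / sqrt (real (n m)))\<^sup>2
      - (a + b) * (real (k m) / sqrt (real (n m)) * sqrt (1 / real (n m))) + a * b * (1 / real (n m))) /
      (1 + real (k m) / sqrt (real (n m)) * sqrt (1 / real (n m)) - d * (1 / real (n m))))
      \<longlonglongrightarrow> (c\<^sup>2 - (a + b) * 0 + a * b * 0) / (1 + 0 - d * 0)"
    by (intro tendsto_intros k lin i) simp
  moreover have "\<forall>\<^sub>F m in sequentially. ((real (k m) / sqrt (real (n m)))\<^sup>2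
      - (a + b) * (real (k m) / sqrt (real (n m)) * sqrt (1 / real (n m))) + a * b * (1 / real (n m))) /
      (1 + real (k m) / sqrt (real (n m)) * sqrt (1 / real (n m)) - d * (1 / real (n m))) =
      (real (k m) - a) * (real (k m) - b) / (real (n m) + real (k m) - d)"
    using eventually_compose_filterlim [OF eventually_gt_at_top [of 0] n]
  proof eventually_elim
    case (elim m)
    define x y where "x = real (n m)" and "y = real (k m)"
    have x: "x > 0" using elim by (simp add: x_def)
    have 1: "(y / sqrt x)\<^sup>2 = y\<^sup>2 / x" "y / sqrt x * sqrt (1 / x) = y / x"
      using x by (simp_all add: power_divide real_sqrt_divide)
    have "(y\<^sup>2 / x - (a + b) * (y / x) + a * b * (1 / x)) / (1 + y / x - d * (1 / x)) =
        ((y - a) * (y - b) / x) / ((x + y - d) / x)"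
      using x by (intro arg_cong2 [where f = "(/)"]) (simp_all add: field_simps power2_eq_square)
    also have "\<dots> = (y - a) * (y - b) / (x + y - d)"
      using x by simp
    finally show ?case
      unfolding x_def [symmetric] y_def [symmetric] 1 .
  qed
  ultimately show ?thesis
    by (simp add: tendsto_cong)
qed

lemma pgf_S_dist_tendsto:
  fixes n k :: "nat \<Rightarrow> nat"
  assumes n: "filterlim n at_top sequentially"
    and k: "(\<lambda>m. real (k m) / sqrt (real (n m))) \<longlonglongrightarrow> c"
    and z: "norm z \<le> 1"
  shows "(\<lambda>m. pgf (S_dist (n m) (k m)) z) \<longlonglongrightarrow> exp (of_real (c\<^sup>2) * (z - 1))"
proof -
  have n0: "\<forall>\<^sub>F m in sequentially. n m > 0"
    by (rule eventually_compose_filterlim [OF eventually_gt_at_top [of 0] n])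
  let ?mean = "\<lambda>m. S_mean (n m) (k m)" and ?var = "\<lambda>m. S_var (n m) (k m)"
  have mean: "?mean \<longlonglongrightarrow> c\<^sup>2"
  proof (rule Lim_transform_eventually)
    show "(\<lambda>m. (real (k m) - 0) * (real (k m) - 1) / (real (n m) + real (k m) - 1)) \<longlonglongrightarrow> c\<^sup>2"
      by (rule tendsto_quadratic_ratio [OF n k])
    show "\<forall>\<^sub>F m in sequentially. (real (k m) - 0) * (real (k m) - 1) / (real (n m) + real (k m) - 1) = ?mean m"
      using n0 by eventually_elim (simp add: S_mean_def S_dist_moments)
  qed
  \<comment> \<open>E - V = E^2 - E(S(S-1)), and both terms tend to c^4.\<close>
  have "(\<lambda>m. ?mean m - ?var m) \<longlonglongrightarrow> (c\<^sup>2)\<^sup>2 - c\<^sup>2 * c\<^sup>2"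
  proof (rule Lim_transform_eventually)
    show "(\<lambda>m. (?mean m)\<^sup>2 - ?mean m * ((real (k m) - 1) * (real (k m) - 2) / (real (n m) + real (k m) - 2)))
        \<longlonglongrightarrow> (c\<^sup>2)\<^sup>2 - c\<^sup>2 * c\<^sup>2"
      by (intro tendsto_intros mean tendsto_quadratic_ratio [OF n k])
    show "\<forall>\<^sub>F m in sequentially. (?mean m)\<^sup>2 -
        ?mean m * ((real (k m) - 1) * (real (k m) - 2) / (real (n m) + real (k m) - 2)) = ?mean m - ?var m"
      using n0 by eventually_elim (simp add: S_var_eq S_mean_def S_dist_moments power2_eq_square)
  qed
  then have "(\<lambda>m. 4 * exp 2 * (?mean m - ?var m)) \<longlonglongrightarrow> 4 * exp 2 * 0"
    by (intro tendsto_mult tendsto_const) (simp add: power2_eq_square)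
  then have "(\<lambda>m. 4 * exp 2 * (?mean m - ?var m)) \<longlonglongrightarrow> 0"
    by simp
  moreover have "\<forall>\<^sub>F m in sequentially. norm (pgf (S_dist (n m) (k m)) z - exp (of_real (?mean m) * (z - 1))) \<le>
      4 * exp 2 * (?mean m - ?var m)"
    using n0
  proof eventually_elim
    case (elim m)
    obtain d p where "poisson_binomial (S_dist (n m) (k m)) d p"
      using poisson_binomial_S_dist elim by blast
    then show ?case
      unfolding S_mean_def S_var_def using z by (rule poisson_binomial_poisson_approx)
  qed
  ultimately have "(\<lambda>m. pgf (S_dist (n m) (k m)) z - exp (of_real (?mean m) * (z - 1))) \<longlonglongrightarrow> 0"
    by (rule Lim_null_comparison [rotated])
  moreover have "(\<lambda>m. exp (of_real (?mean m) * (z - 1))) \<longlonglongrightarrow> exp (of_real (c\<^sup>2) * (z - 1))"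
    by (intro tendsto_intros mean)
  ultimately show ?thesis
    using tendsto_add by fastforce
qed

text \<open>The case c = 0 is kept apart since \<open>pgf_poisson\<close> asks for a positive rate;
  here the limit of the generating function is simply 1.\<close>

lemma S_law_tendsto_dirac0:
  fixes n k :: "nat \<Rightarrow> nat"
  assumes "filterlim n at_top sequentially"
    and "(\<lambda>m. real (k m) / sqrt (real (n m))) \<longlonglongrightarrow> 0"
  shows "weak_conv_m (\<lambda>m. S_law (n m) (k m)) dirac0"
  unfolding S_law_def dirac0_def
proof (rule levy_continuity_pmf_pmf)
  fix t
  have "char (measure_pmf (return_pmf 0)) t = 1"
    by (simp add: char_def)
  then show "(\<lambda>m. char (measure_pmf (map_pmf real (S_dist (n m) (k m)))) t) \<longlonglongrightarrow>
      char (measure_pmf (return_pmf 0)) t"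
    using pgf_S_dist_tendsto [OF assms, of "iexp t"] by (simp add: char_map_pmf_real)
qed

lemma S_law_tendsto_Po_law:
  fixes n k :: "nat \<Rightarrow> nat"
  assumes "c > 0" "filterlim n at_top sequentially"
    and "(\<lambda>m. real (k m) / sqrt (real (n m))) \<longlonglongrightarrow> c"
  shows "weak_conv_m (\<lambda>m. S_law (n m) (k m)) (Po_law (c\<^sup>2))"
  unfolding S_law_def Po_law_def
  by (rule levy_continuity_pmf_pmf)
    (use pgf_S_dist_tendsto [OF assms(2,3)] assms(1) in \<open>simp add: char_map_pmf_real pgf_poisson\<close>)

lemma S_shift_law_eq_S_law:
  assumes "n > 0" "k > 0"
  shows "S_shift_law n k = S_law k n"
proof -
  have "map_pmf real (S_dist k n) = map_pmf (\<lambda>s. real (s + n - k)) (S_dist n k)"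
    by (simp add: S_dist_swap [OF assms, symmetric] map_pmf_comp)
  also have "\<dots> = map_pmf (\<lambda>s. real s - real k + real n) (S_dist n k)"
    using assms by (intro map_pmf_cong refl) (auto simp: set_pmf_S_dist of_nat_diff)
  finally show ?thesis
    by (simp add: S_shift_law_def S_law_def)
qed

text \<open>Needed because \<open>S_shift_law_eq_S_law\<close> holds only for positive arguments,
  which divergence to infinity guarantees only eventually.\<close>

lemma weak_conv_m_cong:
  assumes "\<forall>\<^sub>F m in sequentially. M m = N m" and "weak_conv_m M L"
  shows "weak_conv_m N L"
  unfolding weak_conv_m_def weak_conv_def
proof (intro allI impI)
  fix x assume "isCont (cdf L) x"
  then have "(\<lambda>m. cdf (M m) x) \<longlonglongrightarrow> cdf L x"
    using assms(2) by (simp add: weak_conv_m_def weak_conv_def)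
  then show "(\<lambda>m. cdf (N m) x) \<longlonglongrightarrow> cdf L x"
    by (rule Lim_transform_eventually) (use assms(1) in eventually_elim, simp)
qed

lemma S_std_law_tendsto_normal:
  fixes n k :: "nat \<Rightarrow> nat"
  assumes n: "filterlim n at_top sequentially" and k: "filterlim k at_top sequentially"
    and kn: "filterlim (\<lambda>m. real (k m) / sqrt (real (n m))) at_top sequentially"
    and nk: "(\<lambda>m. real (k m) / real (n m) ^ 2) \<longlonglongrightarrow> 0"
  shows "weak_conv_m (\<lambda>m. S_std_law (n m) (k m)) std_normal_distribution"
  unfolding S_std_law_def
proof (rule levy_continuity_pmf)
  show "real_distribution std_normal_distribution"
    by (rule real_dist_normal_dist)
  fix t
  let ?V = "\<lambda>m. S_var (n m) (k m)"
  have nk1: "\<forall>\<^sub>F m in sequentially. n m > 1 \<and> k m > 1"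
    by (intro eventually_conj eventually_compose_filterlim [OF eventually_gt_at_top [of 1]] n k)
  \<comment> \<open>The square of sqrt n / k is n / k^2, the first term of the bound on 1 /
    V.\<close>
  have "(\<lambda>m. (1 / (real (k m) / sqrt (real (n m))))\<^sup>2) \<longlonglongrightarrow> 0\<^sup>2"
    by (intro tendsto_power tendsto_divide_0 [OF tendsto_const] filterlim_at_top_imp_at_infinity kn)
  then have "(\<lambda>m. real (n m) / (real (k m))\<^sup>2) \<longlonglongrightarrow> 0"
    by (simp add: power_divide)
  from tendsto_mult [OF tendsto_const [of 16] tendsto_add [OF this nk]]
  have B: "(\<lambda>m. 16 * (real (n m) / (real (k m))\<^sup>2 + real (k m) / (real (n m))\<^sup>2)) \<longlonglongrightarrow> 0"
    by simp
  have V: "(\<lambda>m. 1 / ?V m) \<longlonglongrightarrow> 0"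
  proof (rule Lim_null_comparison [OF _ B])
    show "\<forall>\<^sub>F m in sequentially. norm (1 / ?V m) \<le>
        16 * (real (n m) / (real (k m))\<^sup>2 + real (k m) / (real (n m))\<^sup>2)"
      using nk1
    proof eventually_elim
      case (elim m)
      then show ?case
        using S_var_lower_bound [of "n m" "k m"] by simp
    qed
  qed
  have "(\<lambda>m. \<bar>t\<bar> ^ 3 * sqrt (1 / ?V m) + t ^ 4 * (1 / ?V m)) \<longlonglongrightarrow> \<bar>t\<bar> ^ 3 * sqrt 0 + t ^ 4 * 0"
    by (intro tendsto_intros V)
  then have "(\<lambda>m. \<bar>t\<bar> ^ 3 * sqrt (1 / ?V m) + t ^ 4 * (1 / ?V m)) \<longlonglongrightarrow> 0"
    by simp
  moreover have "\<forall>\<^sub>F m in sequentially. cmod (char (measure_pmf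
      (map_pmf (\<lambda>s. (real s - S_mean (n m) (k m)) / sqrt (?V m)) (S_dist (n m) (k m)))) t
      - of_real (exp (- (t\<^sup>2 / 2)))) \<le> \<bar>t\<bar> ^ 3 * sqrt (1 / ?V m) + t ^ 4 * (1 / ?V m)"
    using nk1
  proof eventually_elim
    case (elim m)
    then obtain d p where "poisson_binomial (S_dist (n m) (k m)) d p"
      using poisson_binomial_S_dist [of "n m" "k m"] by auto
    then show ?case
      by (rule poisson_binomial_normal_approx)
        (use elim S_var_lower_bound [of "n m" "k m"] in \<open>simp_all add: S_mean_def S_var_def\<close>)
  qed
  ultimately have "(\<lambda>m. char (measure_pmf
      (map_pmf (\<lambda>s. (real s - S_mean (n m) (k m)) / sqrt (?V m)) (S_dist (n m) (k m)))) t
      - of_real (exp (- (t\<^sup>2 / 2)))) \<longlonglongrightarrow> 0"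
    by (rule Lim_null_comparison [rotated])
  then show "(\<lambda>m. char (measure_pmf
      (map_pmf (\<lambda>s. (real s - S_mean (n m) (k m)) / sqrt (?V m)) (S_dist (n m) (k m)))) t)
      \<longlonglongrightarrow> char std_normal_distribution t"
    by (simp add: char_std_normal_distribution LIM_zero_iff)
qed

theorem mainTheorem12:
  shows
   "(\<forall>(n::nat\<Rightarrow>nat) (k::nat\<Rightarrow>nat).
       filterlim n at_top sequentially \<and>
       (\<lambda>m. real (k m) / sqrt (real (n m))) \<longlonglongrightarrow> 0
       \<longrightarrow> weak_conv_m (\<lambda>m. S_law (n m) (k m)) dirac0)
  \<and> (\<forall>(n::nat\<Rightarrow>nat) (k::nat\<Rightarrow>nat).
       filterlim k at_top sequentially \<and> (\<forall>m. 1 \<le> n m) \<and>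
       (\<lambda>m. real (n m) / sqrt (real (k m))) \<longlonglongrightarrow> 0
       \<longrightarrow> weak_conv_m (\<lambda>m. S_shift_law (n m) (k m)) dirac0)
  \<and> (\<forall>(n::nat\<Rightarrow>nat) (k::nat\<Rightarrow>nat) (c::real).
       c > 0 \<and> filterlim n at_top sequentially \<and> filterlim k at_top sequentially \<and>
       (\<lambda>m. real (k m) / sqrt (real (n m))) \<longlonglongrightarrow> c
       \<longrightarrow> weak_conv_m (\<lambda>m. S_law (n m) (k m)) (Po_law (c^2)))
  \<and> (\<forall>(n::nat\<Rightarrow>nat) (k::nat\<Rightarrow>nat) (c::real).
       c > 0 \<and> filterlim n at_top sequentially \<and> filterlim k at_top sequentially \<and>
       (\<lambda>m. real (n m) / sqrt (real (k m))) \<longlonglongrightarrow> c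
       \<longrightarrow> weak_conv_m (\<lambda>m. S_shift_law (n m) (k m)) (Po_law (c^2)))
  \<and> (\<forall>(n::nat\<Rightarrow>nat) (k::nat\<Rightarrow>nat).
       filterlim n at_top sequentially \<and> filterlim k at_top sequentially \<and>
       filterlim (\<lambda>m. real (k m) / sqrt (real (n m))) at_top sequentially \<and>
       (\<lambda>m. real (k m) / real (n m) ^ 2) \<longlonglongrightarrow> 0
       \<longrightarrow> weak_conv_m (\<lambda>m. S_std_law (n m) (k m)) std_normal_distribution)"
proof -
  have pos: "\<forall>\<^sub>F m in sequentially. n m > 0" if "filterlim n at_top sequentially" for n :: "nat \<Rightarrow> nat"
    by (rule eventually_compose_filterlim [OF eventually_gt_at_top [of 0] that])
  have shift: "weak_conv_m (\<lambda>m. S_shift_law (n m) (k m)) L"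
    if "filterlim k at_top sequentially" and "\<forall>\<^sub>F m in sequentially. n m > 0"
      and "weak_conv_m (\<lambda>m. S_law (k m) (n m)) L" for n k :: "nat \<Rightarrow> nat" and L
  proof (rule weak_conv_m_cong [OF _ that(3)])
    show "\<forall>\<^sub>F m in sequentially. S_law (k m) (n m) = S_shift_law (n m) (k m)"
      using that(2) pos [OF that(1)] by eventually_elim (simp add: S_shift_law_eq_S_law)
  qed
  have shift_dirac: "weak_conv_m (\<lambda>m. S_shift_law (n m) (k m)) dirac0"
    if "filterlim k at_top sequentially" "\<forall>m. 1 \<le> n m"
      "(\<lambda>m. real (n m) / sqrt (real (k m))) \<longlonglongrightarrow> 0" for n k :: "nat \<Rightarrow> nat"
    using that by (intro shift S_law_tendsto_dirac0) (auto simp: Suc_le_eq)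
  show ?thesis
    by (intro conjI allI impI; elim conjE)
      (blast intro: S_law_tendsto_dirac0 S_law_tendsto_Po_law S_std_law_tendsto_normal
        shift_dirac shift [OF _ pos])+
qed

end
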